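(* Let $n\ge 1$. Let $P_n$ denote the total number of fixed points of all elements of $\mathcal{IS}_n$, that is, the number of pairs $(\alpha,x)$ with $\alpha\in\mathcal{IS}_n$, $x\in\operatorname{dom}(\alpha)$ and $\alpha(x)=x$, and let $L_n$ denote the total number of chains in the chain decompositions of all elements of $\mathcal{IS}_n$. Then $$P_n+\frac{1}{n}L_n=|\mathcal{IS}_n|.$$
   Context: Let $N=\{1,2,\dots,n\}$. $\mathcal{IS}_n$ is the symmetric inverse semigroup, i.e. the set of all partial injective maps $\alpha$ from $N$ to $N$ (bijections from a subset $\operatorname{dom}(\alpha)\subseteq N$ onto a subset $\operatorname{im}(\alpha)\subseteq N$; the empty map is allowed). The graph of the action of $\alpha$ is the directed graph on $N$ with an arrow $x\to\alpha(x)$ for each $x\in\operatorname{dom}(\alpha)$. Each connected component is either a directed cycle (a fixed point is a cycle of length 1) or a directed path $a_1\to a_2\to\dots\to a_k$, $k\ge1$, with $a_1\notin\operatorname{im}(\alpha)$ and $a_k\notin\operatorname{dom}(\alpha)$ (a "chain" of $\alpha$; a chain of length 1 is a point $x\notin\operatorname{dom}(\alpha)\cup\operatorname{im}(\alpha)$). This is the chain decomposition of $\alpha$. *)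

theory Defs
  imports Complex_Main
begin

definition sym_inv_semigroup :: "nat \<Rightarrow> (nat \<rightharpoonup> nat) set" where
  "sym_inv_semigroup n = {\<alpha>. dom \<alpha> \<subseteq> {1..n} \<and> ran \<alpha> \<subseteq> {1..n} \<and> inj_on \<alpha> (dom \<alpha>)}"

definition action_graph :: "(nat \<rightharpoonup> nat) \<Rightarrow> (nat \<times> nat) set" where
  "action_graph \<alpha> = {(x, y). \<alpha> x = Some y}"

text \<open>Connected components are taken in the undirected sense. For a map in
  \<open>sym_inv_semigroup n\<close> no arrow leaves \<open>{1..n}\<close>, so every class is a subset of \<open>{1..n}\<close>.\<close>

definition components :: "nat \<Rightarrow> (nat \<rightharpoonup> nat) \<Rightarrow> nat set set" where
  "components n \<alpha> = {1..n} // (action_graph \<alpha> \<union> (action_graph \<alpha>)\<inverse>)\<^sup>*"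

definition maximal_path :: "(nat \<rightharpoonup> nat) \<Rightarrow> nat list \<Rightarrow> bool" where
  "maximal_path \<alpha> as \<longleftrightarrow>
     as \<noteq> [] \<and> distinct as \<and> successively (\<lambda>x y. (x, y) \<in> action_graph \<alpha>) as \<and>
     hd as \<notin> ran \<alpha> \<and> last as \<notin> dom \<alpha>"

definition chains :: "nat \<Rightarrow> (nat \<rightharpoonup> nat) \<Rightarrow> nat set set" where
  "chains n \<alpha> = {C \<in> components n \<alpha>. \<exists>as. maximal_path \<alpha> as \<and> set as = C}"

definition total_fixed_points :: "nat \<Rightarrow> nat" where
  "total_fixed_points n = card {(\<alpha>, x). \<alpha> \<in> sym_inv_semigroup n \<and> \<alpha> x = Some x}"

definition total_chains :: "nat \<Rightarrow> nat" where
  "total_chains n = (\<Sum>\<alpha>\<in>sym_inv_semigroup n. card (chains n \<alpha>))"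

lemma finite_sym_inv_semigroup: "finite (sym_inv_semigroup n)"
proof (rule finite_subset)
  show "sym_inv_semigroup n \<subseteq> (\<Union>D\<in>Pow {1..n}. {\<alpha>. dom \<alpha> = D \<and> ran \<alpha> \<subseteq> {1..n}})"
    by (auto simp: sym_inv_semigroup_def)
  show "finite (\<Union>D\<in>Pow {1..n}. {\<alpha>. dom \<alpha> = D \<and> ran \<alpha> \<subseteq> {1..n::nat}})"
    by (intro finite_UN_I finite_set_of_finite_maps)
       (auto intro: finite_subset[OF _ finite_atLeastAtMost])
qed

end

theory Submission
  imports Defs "HOL-Combinatorics.Transposition"
begin

text \<open>
  Both sides count pairs \<open>(\<alpha>, x)\<close> once the identity is multiplied by \<open>n\<close>. A chain has exactly one
  point outside \<open>dom \<alpha>\<close>, namely its last one, and every point outside \<open>dom \<alpha>\<close> ends a chain, so the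
  number of chains of \<open>\<alpha>\<close> is the number of points outside \<open>dom \<alpha>\<close> (\<open>card_chains\<close>). The total number
  of chains is therefore the number of pairs \<open>(\<alpha>, x)\<close> with \<open>x \<notin> dom \<alpha>\<close>, and what is left to show is
  that the pairs with \<open>x \<in> dom \<alpha>\<close> are \<open>n\<close> times as many as the pairs with \<open>\<alpha> x = x\<close>. This is a
  symmetry: composing with the transposition of \<open>x\<close> and \<open>y\<close> turns the maps sending \<open>x\<close> to \<open>y\<close>
  bijectively into those fixing \<open>x\<close>, so each of the \<open>n\<close> possible values of \<open>\<alpha> x\<close> is taken equally
  often (\<open>card_value_eq_card_fixed\<close>).
\<close>

section \<open>Chains correspond to points outside the domain\<close>

abbreviation connected_rel :: "(nat \<rightharpoonup> nat) \<Rightarrow> (nat \<times> nat) set" where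
  "connected_rel \<alpha> \<equiv> (action_graph \<alpha> \<union> (action_graph \<alpha>)\<inverse>)\<^sup>*"

lemma equiv_connected_rel: "equiv UNIV (connected_rel \<alpha>)"
proof -
  have "sym (connected_rel \<alpha>)"
    by (intro sym_rtrancl sym_Un_converse)
  then show ?thesis
    by (simp add: equiv_def refl_rtrancl trans_rtrancl)
qed

lemma sym_inv_semigroup_range:
  assumes "\<alpha> \<in> sym_inv_semigroup n" "\<alpha> x = Some y"
  shows "x \<in> {1..n}" "y \<in> {1..n}"
  using assms by (auto simp: sym_inv_semigroup_def dom_def ran_def subset_iff)

lemma sym_inv_semigroup_inj:
  assumes "\<alpha> \<in> sym_inv_semigroup n" "\<alpha> x = Some z" "\<alpha> y = Some z"
  shows "x = y"
  using assms by (auto simp: sym_inv_semigroup_def inj_on_def dom_def)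

lemma connected_rel_stays:
  assumes "\<alpha> \<in> sym_inv_semigroup n" "(x, y) \<in> connected_rel \<alpha>" "x \<in> {1..n}"
  shows "y \<in> {1..n}"
  using assms(2,3)
  by (induction rule: rtrancl_induct)
     (use sym_inv_semigroup_range[OF assms(1)] in \<open>auto simp: action_graph_def\<close>)

lemma path_successor:
  assumes "successively (\<lambda>x y. (x, y) \<in> action_graph \<alpha>) as" "u \<in> set as" "u \<noteq> last as"
  shows "\<exists>v \<in> set as. \<alpha> u = Some v"
proof -
  obtain ys zs where "as = ys @ u # zs"
    using assms(2) by (meson split_list)
  with assms(1,3) show ?thesis
    by (cases zs) (auto simp: successively_append_iff action_graph_def)
qed

lemma path_predecessor:
  assumes "successively (\<lambda>x y. (x, y) \<in> action_graph \<alpha>) as" "u \<in> set as" "u \<noteq> hd as"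
  shows "\<exists>v \<in> set as. \<alpha> v = Some u"
proof -
  obtain ys zs where "as = ys @ u # zs"
    using assms(2) by (meson split_list)
  with assms(1,3) show ?thesis
    by (cases ys rule: rev_cases) (auto simp: successively_append_iff action_graph_def)
qed

lemma successively_imp_connected:
  assumes "successively (\<lambda>x y. (x, y) \<in> action_graph \<alpha>) as" "u \<in> set as"
  shows "(u, last as) \<in> connected_rel \<alpha>"
  using assms
proof (induction as arbitrary: u)
  case (Cons a as)
  show ?case
  proof (cases "as = []")
    case True
    with Cons.prems show ?thesis by auto
  next
    case False
    with Cons.prems have step: "(a, hd as) \<in> action_graph \<alpha>"
      and succ: "successively (\<lambda>x y. (x, y) \<in> action_graph \<alpha>) as"
      by (auto simp: successively_Cons)
    have tail: "(w, last as) \<in> connected_rel \<alpha>" if "w \<in> set as" for w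
      using Cons.IH succ that by blast
    have "(a, last as) \<in> connected_rel \<alpha>"
      using step tail[of "hd as"] False by (auto intro: converse_rtrancl_into_rtrancl)
    with tail Cons.prems False show ?thesis by auto
  qed
qed simp

text \<open>
  A maximal path cannot be left: an arrow out of a point that is not the last goes to the next
  point, by injectivity an arrow into a point that is not the first comes from the previous one,
  and there is no arrow out of the last or into the first point.
\<close>

lemma maximal_path_eq_class:
  assumes "\<alpha> \<in> sym_inv_semigroup n" "maximal_path \<alpha> as"
  shows "connected_rel \<alpha> `` {last as} = set as"
proof
  have succ: "successively (\<lambda>x y. (x, y) \<in> action_graph \<alpha>) as"
    and ends: "as \<noteq> []" "hd as \<notin> ran \<alpha>" "last as \<notin> dom \<alpha>"
    using assms(2) by (auto simp: maximal_path_def)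
  have closed: "w \<in> set as"
    if u: "u \<in> set as" and uw: "(u, w) \<in> action_graph \<alpha> \<union> (action_graph \<alpha>)\<inverse>" for u w
  proof (cases "\<alpha> u = Some w")
    case True
    then have "u \<noteq> last as"
      using ends by auto
    with path_successor[OF succ u] True show ?thesis by auto
  next
    case False
    then have w: "\<alpha> w = Some u"
      using uw by (auto simp: action_graph_def)
    then have "u \<noteq> hd as"
      using ends by (auto simp: ran_def)
    then obtain v where "v \<in> set as" "\<alpha> v = Some u"
      using path_predecessor[OF succ u] by auto
    with w sym_inv_semigroup_inj[OF assms(1)] show ?thesis by metis
  qed
  have "w \<in> set as" if "(last as, w) \<in> connected_rel \<alpha>" for w
    using that by (induction rule: rtrancl_induct) (use ends closed in auto)
  then show "connected_rel \<alpha> `` {last as} \<subseteq> set as" by auto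
  show "set as \<subseteq> connected_rel \<alpha> `` {last as}"
    using successively_imp_connected[OF succ] equiv_connected_rel[of \<alpha>]
    by (auto simp: equiv_def dest: symD)
qed

text \<open>
  A longest path ending in \<open>x\<close> is maximal. If its first point had a preimage, the path could be
  extended backwards: the preimage is not yet on the path, since \<open>x\<close> has no image and any other
  point of the path is sent to its successor, which is never the first point. The length is bounded
  because the points of a path are distinct elements of \<open>{1..n}\<close>.
\<close>

lemma maximal_path_exists:
  assumes \<alpha>: "\<alpha> \<in> sym_inv_semigroup n" and x: "x \<in> {1..n}" "x \<notin> dom \<alpha>"
  obtains as where "maximal_path \<alpha> as" "last as = x"
proof -
  define P where "P as \<longleftrightarrow> as \<noteq> [] \<and> distinct as \<and>
     successively (\<lambda>x y. (x, y) \<in> action_graph \<alpha>) as \<and> last as = x" for as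
  have start: "P [x]"
    by (simp add: P_def)
  have "length as < Suc n" if "P as" for as
  proof -
    have "set as \<subseteq> {1..n}"
    proof
      fix u assume "u \<in> set as"
      then show "u \<in> {1..n}"
        using path_successor[of \<alpha> as u] that x sym_inv_semigroup_range(1)[OF \<alpha>]
        by (cases "u = x") (auto simp: P_def)
    qed
    then have "card (set as) \<le> n"
      using card_mono[of "{1..n}" "set as"] by simp
    then show ?thesis
      using that by (simp add: P_def distinct_card)
  qed
  then obtain as where as: "P as" and longest: "\<And>bs. P bs \<Longrightarrow> length bs \<le> length as"
    using ex_has_greatest_nat[of P "[x]" length "Suc n"] start by auto
  have "hd as \<notin> ran \<alpha>"
  proof
    assume "hd as \<in> ran \<alpha>"
    then obtain z where z: "\<alpha> z = Some (hd as)"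
      by (auto simp: ran_def)
    have "z \<notin> set as"
    proof
      assume "z \<in> set as"
      then obtain ys zs where split: "as = ys @ z # zs"
        by (meson split_list)
      show False
      proof (cases zs)
        case Nil
        with split as z x show False by (auto simp: P_def)
      next
        case (Cons v vs)
        with split as have "\<alpha> z = Some v"
          by (auto simp: P_def successively_append_iff action_graph_def)
        with z have "v = hd as" by simp
        moreover have "v \<noteq> hd (ys @ z # v # vs)"
          using as by (cases ys) (auto simp: P_def split Cons)
        ultimately show False
          using split Cons by simp
      qed
    qed
    with as z have "P (z # as)"
      by (auto simp: P_def successively_Cons action_graph_def)
    from longest[OF this] show False by simp
  qed
  with as x have "maximal_path \<alpha> as" "last as = x"
    by (auto simp: P_def maximal_path_def)
  then show thesis by (rule that)
qed

text \<open>
  Every chain is the component of the end of its maximal path, and it contains no other point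
  outside the domain because every earlier point of the path has an image.
\<close>

lemma card_chains:
  assumes \<alpha>: "\<alpha> \<in> sym_inv_semigroup n"
  shows "card (chains n \<alpha>) = card ({1..n} - dom \<alpha>)"
proof -
  let ?cl = "\<lambda>x. connected_rel \<alpha> `` {x}"
  have "inj_on ?cl ({1..n} - dom \<alpha>)"
  proof (rule inj_onI)
    fix x y
    assume x: "x \<in> {1..n} - dom \<alpha>" and y: "y \<in> {1..n} - dom \<alpha>" and eq: "?cl x = ?cl y"
    obtain as where as: "maximal_path \<alpha> as" "last as = x"
      using maximal_path_exists[OF \<alpha>] x by blast
    then have "y \<in> set as"
      using maximal_path_eq_class[OF \<alpha> as(1)] eq by auto
    then show "x = y"
      using path_successor[of \<alpha> as y] as y by (auto simp: maximal_path_def)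
  qed
  moreover have "?cl ` ({1..n} - dom \<alpha>) = chains n \<alpha>"
  proof
    show "?cl ` ({1..n} - dom \<alpha>) \<subseteq> chains n \<alpha>"
    proof
      fix C assume "C \<in> ?cl ` ({1..n} - dom \<alpha>)"
      then obtain x where x: "x \<in> {1..n}" "x \<notin> dom \<alpha>" "C = ?cl x"
        by blast
      obtain as where as: "maximal_path \<alpha> as" "last as = x"
        using maximal_path_exists[OF \<alpha> x(1,2)] .
      have "set as = C"
        using maximal_path_eq_class[OF \<alpha> as(1)] as(2) x(3) by simp
      moreover have "C \<in> components n \<alpha>"
        using x by (auto simp: components_def intro: quotientI)
      ultimately show "C \<in> chains n \<alpha>"
        using as(1) by (auto simp: chains_def)
    qed
    show "chains n \<alpha> \<subseteq> ?cl ` ({1..n} - dom \<alpha>)"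
    proof
      fix C assume "C \<in> chains n \<alpha>"
      then obtain as z where as: "maximal_path \<alpha> as" "set as = C"
        and z: "z \<in> {1..n}" "C = ?cl z"
        by (auto simp: chains_def components_def elim!: quotientE)
      have "last as \<in> C" "last as \<notin> dom \<alpha>"
        using as by (auto simp: maximal_path_def)
      moreover have "last as \<in> {1..n}"
        using connected_rel_stays[OF \<alpha>, of z "last as"] z \<open>last as \<in> C\<close> by blast
      moreover have "C = ?cl (last as)"
        using maximal_path_eq_class[OF \<alpha> as(1)] as(2) by simp
      ultimately show "C \<in> ?cl ` ({1..n} - dom \<alpha>)" by blast
    qed
  qed
  ultimately show ?thesis
    using card_image by metis
qed

section \<open>All values at a point are equally frequent\<close>

lemma map_option_transpose_mem:
  assumes "\<alpha> \<in> sym_inv_semigroup n" "x \<in> {1..n}" "y \<in> {1..n}"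
  shows "map_option (transpose x y) \<circ> \<alpha> \<in> sym_inv_semigroup n"
proof -
  have "ran (map_option (transpose x y) \<circ> \<alpha>) \<subseteq> {1..n}"
    using assms sym_inv_semigroup_range(2)[OF assms(1)]
    by (auto simp: ran_def transpose_def)
  moreover have "inj_on (map_option (transpose x y) \<circ> \<alpha>) (dom \<alpha>)"
    using assms(1)
    by (intro comp_inj_on)
       (auto simp: sym_inv_semigroup_def intro: inj_on_subset[OF option.inj_map[OF inj_transpose]])
  moreover have "dom (map_option (transpose x y) \<circ> \<alpha>) = dom \<alpha>"
    by (auto simp: dom_def)
  ultimately show ?thesis
    using assms(1) by (simp add: sym_inv_semigroup_def)
qed

lemma card_value_eq_card_fixed:
  assumes "x \<in> {1..n}" "y \<in> {1..n}"
  shows "card {\<alpha> \<in> sym_inv_semigroup n. \<alpha> x = Some y} =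
         card {\<alpha> \<in> sym_inv_semigroup n. \<alpha> x = Some x}"
proof (rule bij_betw_same_card)
  let ?f = "\<lambda>\<alpha>. map_option (transpose x y) \<circ> \<alpha>"
  have "?f (?f \<alpha>) = \<alpha>" for \<alpha> :: "nat \<rightharpoonup> nat"
    by (simp add: fun_eq_iff option.map_comp option.map_id0 o_def option.map_ident)
  then show "bij_betw ?f {\<alpha> \<in> sym_inv_semigroup n. \<alpha> x = Some y}
                         {\<alpha> \<in> sym_inv_semigroup n. \<alpha> x = Some x}"
    by (intro bij_betw_byWitness[where f' = ?f])
       (auto intro: map_option_transpose_mem[OF _ assms])
qed

section \<open>The counting identity\<close>

lemma total_fixed_points_eq_sum:
  "total_fixed_points n = (\<Sum>x\<in>{1..n}. card {\<alpha> \<in> sym_inv_semigroup n. \<alpha> x = Some x})"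
proof -
  have "{(\<alpha>, x). \<alpha> \<in> sym_inv_semigroup n \<and> \<alpha> x = Some x} =
        prod.swap ` (SIGMA x:{1..n}. {\<alpha> \<in> sym_inv_semigroup n. \<alpha> x = Some x})"
    using sym_inv_semigroup_range(1) by (fastforce simp: image_iff)
  then show ?thesis
    using finite_sym_inv_semigroup[of n]
    by (simp add: total_fixed_points_def card_image card_SigmaI)
qed

lemma total_chains_eq_sum:
  "total_chains n = (\<Sum>x\<in>{1..n}. card {\<alpha> \<in> sym_inv_semigroup n. x \<notin> dom \<alpha>})"
proof -
  have "total_chains n = (\<Sum>\<alpha>\<in>sym_inv_semigroup n. card {x \<in> {1..n}. x \<notin> dom \<alpha>})"
    unfolding total_chains_def
    by (intro sum.cong refl) (simp add: card_chains set_diff_eq)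
  also have "\<dots> = (\<Sum>x\<in>{1..n}. card {\<alpha> \<in> sym_inv_semigroup n. x \<notin> dom \<alpha>})"
    by (rule sum_multicount_gen) (auto simp: finite_sym_inv_semigroup)
  finally show ?thesis .
qed

text \<open>
  This is the pointwise form of the theorem: summed over \<open>x\<close>, it gives \<open>n\<close> times the identity.
\<close>

lemma card_sym_inv_semigroup_by_value:
  assumes "x \<in> {1..n}"
  shows "card (sym_inv_semigroup n) =
         n * card {\<alpha> \<in> sym_inv_semigroup n. \<alpha> x = Some x} +
         card {\<alpha> \<in> sym_inv_semigroup n. x \<notin> dom \<alpha>}"
proof -
  let ?S = "sym_inv_semigroup n"
  let ?V = "\<lambda>y. {\<alpha> \<in> ?S. \<alpha> x = Some y}"
  have "?S = (\<Union>y\<in>{1..n}. ?V y) \<union> {\<alpha> \<in> ?S. x \<notin> dom \<alpha>}"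
    using sym_inv_semigroup_range(2) by fastforce
  moreover have "card ((\<Union>y\<in>{1..n}. ?V y) \<union> {\<alpha> \<in> ?S. x \<notin> dom \<alpha>}) =
      card (\<Union>y\<in>{1..n}. ?V y) + card {\<alpha> \<in> ?S. x \<notin> dom \<alpha>}"
    by (rule card_Un_disjoint) (auto simp: finite_sym_inv_semigroup)
  moreover have "card (\<Union>y\<in>{1..n}. ?V y) = (\<Sum>y\<in>{1..n}. card (?V y))"
    by (rule card_UN_disjoint) (auto simp: finite_sym_inv_semigroup)
  moreover have "\<dots> = n * card (?V x)"
    using card_value_eq_card_fixed[OF assms] by simp
  ultimately show ?thesis by simp
qed

theorem theorem2:
  fixes n :: nat
  assumes "n \<ge> 1"
  shows "real (total_fixed_points n) + 1 / real n * real (total_chains n)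
           = real (card (sym_inv_semigroup n))"
proof -
  have "n * card (sym_inv_semigroup n) = (\<Sum>x\<in>{1..n}. card (sym_inv_semigroup n))"
    by simp
  also have "\<dots> = n * total_fixed_points n + total_chains n"
    unfolding total_fixed_points_eq_sum total_chains_eq_sum sum_distrib_left
      sum.distrib[symmetric]
    by (rule sum.cong) (simp_all only: card_sym_inv_semigroup_by_value)
  finally have "real n * real (card (sym_inv_semigroup n)) =
      real n * real (total_fixed_points n) + real (total_chains n)"
    by (metis of_nat_add of_nat_mult)
  then show ?thesis
    using assms by (simp add: field_simps)
qed

end
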